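(* Let $n,m$ be non-negative integers and consider the two-user symmetric linear deterministic interference channel with parameters $(n,m)$ and channel output feedback model $(F_{11}F_{12}F_{21}F_{22})$. Its sum-capacity is as follows. (i) For every feedback model of the form $(1\mathsf{xxx})$ (i.e. $F_{11}=1$ and $F_{12},F_{21},F_{22}\in\{0,1\}$ arbitrary): $$C_{\mathrm{sum}}^{(1\mathsf{xxx})}=(n-m)^+ +\max(n,m).$$ (ii) For the feedback models $(0110)$ and $(0010)$: $$C_{\mathrm{sum}}^{(0110)}=C_{\mathrm{sum}}^{(0010)}=\min\{(n-m)^+ +\max(n,m),\;2n\}.$$
   Context: Symmetric linear deterministic interference channel with parameters $(n,m)$: let $q=\max(n,m)$ and let $\mathbf{S}$ be the $q\times q$ matrix over $\mathbb{F}_2$ with ones on the first diagonal below the main diagonal and zeros elsewhere. At time $j$, transmitter $\mathsf{T}_u$ ($u\in\{1,2\}$) sends $X_{uj}\in\mathbb{F}_2^q$ (first entry is the most significant bit), and the receivers $\mathsf{D}_1,\mathsf{D}_2$ receive $$Y_{1j}=\mathbf{S}^{q-n}X_{1j}\oplus \mathbf{S}^{q-m}X_{2j},\qquad Y_{2j}=\mathbf{S}^{q-n}X_{2j}\oplus \mathbf{S}^{q-m}X_{1j}.$$ Feedback model: $(F_{11}F_{12}F_{21}F_{22})\in\{0,1\}^4$, where $F_{ku}=1$ iff there is a noiseless, strictly causal feedback link from receiver $\mathsf{D}_k$ to transmitter $\mathsf{T}_u$. Codes: for block length $N$, $W_u$ is uniform on $\{1,\dots,2^{NR_u}\}$, with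 $W_1,W_2$ independent. The encoder of $\mathsf{T}_u$ is a sequence of functions $X_{uj}=f_{uj}(W_u,\,Y_1^{j-1}F_{1u},\,Y_2^{j-1}F_{2u})$, $j=1,\dots,N$; that is, $X_{uj}$ may depend on $W_u$ and on the past output sequence $Y_k^{j-1}=(Y_{k1},\dots,Y_{k,j-1})$ exactly for those $k$ with $F_{ku}=1$. The decoder of $\mathsf{D}_u$ is a function $\widehat W_u=h_u(Y_u^N)$. A rate pair $(R_1,R_2)$ is achievable if there are codes with $\Pr(\widehat W_u\ne W_u)\to0$ as $N\to\infty$ for both $u=1,2$. The capacity region is the closure of the set of achievable rate pairs, and the sum-capacity $C_{\mathrm{sum}}^{(F_{11}F_{12}F_{21}F_{22})}$ is the maximum of $R_1+R_2$ over the capacity region. Notation: $(x)^+=\max(x,0)$. *)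

theory Defs
  imports "HOL-Probability.Probability" "HOL-Library.Z2" "Jordan_Normal_Form.Matrix"
begin

datatype user = U1 | U2

fun other :: "user \<Rightarrow> user" where
  "other U1 = U2"
| "other U2 = U1"

text \<open>Both \<open>HOL-Analysis\<close> and \<open>Jordan_Normal_Form\<close> have a type called \<open>vec\<close>; here
  \<open>F2vec\<close> always refers to vectors whose dimension is a value, constrained by \<open>carrier_vec\<close>.\<close>

type_synonym F2vec = "bit Matrix.vec"

definition signal_dim :: "nat \<Rightarrow> nat \<Rightarrow> nat" where
  "signal_dim n m = max n m"

definition shift_mat :: "nat \<Rightarrow> bit Matrix.mat" where
  "shift_mat q = Matrix.mat q q (\<lambda>(i, j). if i = j + 1 then 1 else 0)"

definition received :: "nat \<Rightarrow> nat \<Rightarrow> (user \<Rightarrow> F2vec) \<Rightarrow> user \<Rightarrow> F2vec" where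
  "received n m X u =
     (let q = signal_dim n m; S = shift_mat q
      in (S ^\<^sub>m (q - n)) *\<^sub>v X u + (S ^\<^sub>m (q - m)) *\<^sub>v X (other u))"

text \<open>A feedback model \<open>F\<close> has \<open>F k u\<close> iff there is a link from receiver \<open>k\<close> to
  transmitter \<open>u\<close>; \<open>feedback_model\<close> lists the links in the order 11, 12, 21, 22.\<close>

type_synonym feedback = "user \<Rightarrow> user \<Rightarrow> bool"

fun feedback_model :: "bool \<Rightarrow> bool \<Rightarrow> bool \<Rightarrow> bool \<Rightarrow> feedback" where
  "feedback_model F11 F12 F21 F22 U1 U1 = F11"
| "feedback_model F11 F12 F21 F22 U1 U2 = F12"
| "feedback_model F11 F12 F21 F22 U2 U1 = F21"
| "feedback_model F11 F12 F21 F22 U2 U2 = F22"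

text \<open>\<open>f u j w ys1 ys2\<close> is the input of transmitter \<open>u\<close> at time \<open>j\<close> for message \<open>w\<close>, where
  \<open>ys1\<close> and \<open>ys2\<close> are what the transmitter sees of the past outputs of the two receivers
  (oldest first).\<close>

type_synonym encoder = "user \<Rightarrow> nat \<Rightarrow> nat \<Rightarrow> F2vec list \<Rightarrow> F2vec list \<Rightarrow> F2vec"

type_synonym decoder = "user \<Rightarrow> F2vec list \<Rightarrow> nat"

text \<open>A missing link hides the past of the receiver: the encoder is passed the constant \<open>[]\<close>
  in its place.\<close>

definition seen :: "feedback \<Rightarrow> (user \<Rightarrow> F2vec list) \<Rightarrow> user \<Rightarrow> user \<Rightarrow> F2vec list" where
  "seen F Y k u = (if F k u then Y k else [])"

text \<open>\<open>output_seq n m F f w j k\<close> is the list of the first \<open>j\<close> outputs at receiver \<open>k\<close>.\<close>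

primrec output_seq ::
  "nat \<Rightarrow> nat \<Rightarrow> feedback \<Rightarrow> encoder \<Rightarrow> (user \<Rightarrow> nat) \<Rightarrow> nat \<Rightarrow> user \<Rightarrow> F2vec list" where
  "output_seq n m F f w 0 = (\<lambda>k. [])"
| "output_seq n m F f w (Suc j) =
     (let Y = output_seq n m F f w j;
          X = (\<lambda>u. f u (Suc j) (w u) (seen F Y U1 u) (seen F Y U2 u))
      in (\<lambda>k. Y k @ [received n m X k]))"

text \<open>Values of an encoder outside of its intended domain are irrelevant, so that requiring
  the right dimension for all arguments loses no generality.\<close>

definition valid_encoder :: "nat \<Rightarrow> nat \<Rightarrow> encoder \<Rightarrow> bool" where
  "valid_encoder n m f \<longleftrightarrow>
     (\<forall>u j w ys1 ys2. f u j w ys1 ys2 \<in> carrier_vec (signal_dim n m))"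

text \<open>For a general real rate, \<open>2 powr (N * R)\<close> need not be an integer and is rounded down;
  this does not affect the closure of the set of achievable pairs.\<close>

definition num_messages :: "nat \<Rightarrow> real \<Rightarrow> nat" where
  "num_messages N R = nat \<lfloor>2 powr (real N * R)\<rfloor>"

fun message :: "nat \<times> nat \<Rightarrow> user \<Rightarrow> nat" where
  "message (w1, w2) U1 = w1"
| "message (w1, w2) U2 = w2"

definition message_pmf :: "nat \<Rightarrow> nat \<Rightarrow> (nat \<times> nat) pmf" where
  "message_pmf M1 M2 = pair_pmf (pmf_of_set {1..M1}) (pmf_of_set {1..M2})"

definition error_prob ::
  "nat \<Rightarrow> nat \<Rightarrow> feedback \<Rightarrow> nat \<Rightarrow> nat \<Rightarrow> nat \<Rightarrow> encoder \<Rightarrow> decoder \<Rightarrow> user \<Rightarrow> real" where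
  "error_prob n m F N M1 M2 f h u =
     measure_pmf.prob (message_pmf M1 M2)
       {w. h u (output_seq n m F f (message w) N u) \<noteq> message w u}"

definition achievable :: "nat \<Rightarrow> nat \<Rightarrow> feedback \<Rightarrow> real \<Rightarrow> real \<Rightarrow> bool" where
  "achievable n m F R1 R2 \<longleftrightarrow>
     0 \<le> R1 \<and> 0 \<le> R2 \<and>
     (\<exists>(f :: nat \<Rightarrow> encoder) (h :: nat \<Rightarrow> decoder).
        (\<forall>N. valid_encoder n m (f N)) \<and>
        (\<forall>u. (\<lambda>N. error_prob n m F N (num_messages N R1) (num_messages N R2) (f N) (h N) u)
               \<longlonglongrightarrow> 0))"

definition capacity_region :: "nat \<Rightarrow> nat \<Rightarrow> feedback \<Rightarrow> (real \<times> real) set" where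
  "capacity_region n m F = closure {(R1, R2). achievable n m F R1 R2}"

text \<open>The sum-capacity is a maximum; as a relation, it includes that the maximum is attained.\<close>

definition has_sum_capacity :: "nat \<Rightarrow> nat \<Rightarrow> feedback \<Rightarrow> real \<Rightarrow> bool" where
  "has_sum_capacity n m F C \<longleftrightarrow>
     (\<exists>(R1, R2) \<in> capacity_region n m F. R1 + R2 = C) \<and>
     (\<forall>(R1, R2) \<in> capacity_region n m F. R1 + R2 \<le> C)"

end

theory Submission
  imports Defs
begin

text \<open>
  Converse: among the correctly decoded message pairs, the first output sequence together with
  the \<open>n - m\<close> lowest levels of the second one is an injective function of the pair. Indeed the
  first output yields \<open>W\<^sub>1\<close>; from \<open>W\<^sub>1\<close> and the past outputs one gets the current input of the
  first transmitter, hence the interference it suffered, which are the top \<open>m\<close> levels of the second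
  input, hence the rest of the second output, and finally \<open>W\<^sub>2\<close>. Counting gives the bound even
  for full feedback. Without
  \<open>F 1 1\<close> and \<open>F 2 2\<close>, an input is a function of its own message and of the past output at the other
  receiver; for a fixed message of one user, the output at the receiver of the other user
  therefore carries at most \<open>n\<close> new bits per slot, and each rate is at most \<open>n\<close>.

  Achievability: with \<open>F 1 1\<close>, or with \<open>F 2 1\<close> and \<open>m \<le> n\<close>, the first transmitter learns the
  interference suffered by its receiver and forwards it one slot later, on the levels where it is
  itself heard by the second receiver. This is data of the second user, so it does no harm there
  (and serves as a relay if \<open>n < m\<close>), and the first receiver resolves it by decoding backwards.
  The rates are \<open>(n - m)\<^sup>+\<close> and \<open>max n m\<close>. If \<open>n \<le> m\<close>, the rates \<open>min (m - n) n\<close> and \<open>n\<close>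
  are achieved without feedback.
\<close>

unbundle no vec_syntax
notation vec_index (infixl "$" 100)

text \<open>Otherwise sums of bits become \<open>of_bool\<close> of parities, and cancellation no longer applies.\<close>

declare add_bit_eq_xor [simp del]

subsection \<open>The channel\<close>

lemma shift_mat_pow_mult_vec:
  assumes "v \<in> carrier_vec q" "i < q"
  shows "((shift_mat q ^\<^sub>m k) *\<^sub>v v) $ i = (if k \<le> i then v $ (i - k) else 0)"
  using assms
proof (induction k arbitrary: v)
  case 0
  then show ?case by (simp add: shift_mat_def)
next
  case (Suc k)
  have S: "shift_mat q \<in> carrier_mat q q"
    by (simp add: shift_mat_def)
  have shift: "(shift_mat q *\<^sub>v v) $ i = (if 1 \<le> i then v $ (i - 1) else 0)" if "i < q" for i
  proof -
    have "(shift_mat q *\<^sub>v v) $ i = (\<Sum>j = 0..<q. (if i = j + 1 then 1 else 0) * v $ j)"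
      using that Suc.prems by (simp add: shift_mat_def scalar_prod_def)
    also have "\<dots> = (\<Sum>j = 0..<q. if j = i - 1 then (if 1 \<le> i then v $ j else 0) else 0)"
      by (intro sum.cong) auto
    also have "\<dots> = (if 1 \<le> i then v $ (i - 1) else 0)"
      using that by auto
    finally show ?thesis .
  qed
  have "(shift_mat q ^\<^sub>m Suc k) *\<^sub>v v = (shift_mat q ^\<^sub>m k) *\<^sub>v (shift_mat q *\<^sub>v v)"
    using S Suc.prems by (simp add: assoc_mult_mat_vec[of _ q q _ q])
  also have "\<dots> $ i = (if k \<le> i then (shift_mat q *\<^sub>v v) $ (i - k) else 0)"
    using Suc.prems S by (intro Suc.IH) auto
  also have "\<dots> = (if Suc k \<le> i then v $ (i - Suc k) else 0)"
    using Suc.prems by (auto simp: shift)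
  finally show ?case .
qed

lemma received_carrier:
  "X u \<in> carrier_vec (signal_dim n m) \<Longrightarrow> X (other u) \<in> carrier_vec (signal_dim n m)
    \<Longrightarrow> received n m X u \<in> carrier_vec (signal_dim n m)"
  unfolding received_def Let_def
  by (intro add_carrier_vec mult_mat_vec_carrier[of _ _ "signal_dim n m"] pow_carrier_mat)
     (auto simp: shift_mat_def)

lemma received_nth:
  assumes "\<And>u. X u \<in> carrier_vec (signal_dim n m)" "i < signal_dim n m"
  shows "received n m X u $ i =
    (if signal_dim n m - n \<le> i then X u $ (i - (signal_dim n m - n)) else 0) +
    (if signal_dim n m - m \<le> i then X (other u) $ (i - (signal_dim n m - m)) else 0)"
proof -
  have dim: "dim_row (shift_mat q ^\<^sub>m k) = q" for q k
    by (rule carrier_matD(1)[OF pow_carrier_mat]) (simp add: shift_mat_def)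
  have "received n m X u $ i =
      ((shift_mat (signal_dim n m) ^\<^sub>m (signal_dim n m - n)) *\<^sub>v X u) $ i +
      ((shift_mat (signal_dim n m) ^\<^sub>m (signal_dim n m - m)) *\<^sub>v X (other u)) $ i"
    unfolding received_def Let_def using assms(2) by (intro index_add_vec(1)) (simp add: dim shift_mat_def)
  then show ?thesis
    using assms by (simp only: shift_mat_pow_mult_vec)
qed

lemma length_output_seq [simp]: "length (output_seq n m F f w N k) = N"
  by (induction N) (auto simp: Let_def)

lemma output_seq_carrier:
  assumes "valid_encoder n m f"
  shows "set (output_seq n m F f w N k) \<subseteq> carrier_vec (signal_dim n m)"
  using assms
  by (induction N) (auto simp: Let_def valid_encoder_def intro!: received_carrier)

subsection \<open>Realizing codes\<close>

lemma message_range: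
  assumes "M1 \<ge> 1" "M2 \<ge> 1"
  shows "set_pmf (message_pmf M1 M2) = {1..M1} \<times> {1..M2}"
  using assms by (simp add: message_pmf_def)

text \<open>A code may be described by its codewords alone: the encoder is a choice function for
  the codeword symbols, which is well defined because each symbol is determined by what the
  transmitter knows; decoding without error only needs injectivity.\<close>

lemma realize_code:
  fixes X :: "(user \<Rightarrow> nat) \<Rightarrow> nat \<Rightarrow> user \<Rightarrow> F2vec"
  assumes carrier: "\<And>w j u. X w j u \<in> carrier_vec (signal_dim n m)"
    and causal: "\<And>w w' u j. w u = w' u \<Longrightarrow>
      (\<And>k i. F k u \<Longrightarrow> i < j \<Longrightarrow> received n m (X w i) k = received n m (X w' i) k) \<Longrightarrow>
      X w j u = X w' j u"
    and decodable: "\<And>w w' u. (\<And>u. w u \<in> {1..M u}) \<Longrightarrow> (\<And>u. w' u \<in> {1..M u}) \<Longrightarrow>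
      (\<And>i. i < N \<Longrightarrow> received n m (X w i) u = received n m (X w' i) u) \<Longrightarrow> w u = w' u"
    and pos: "\<And>u. M u \<ge> 1"
  shows "\<exists>f h. valid_encoder n m f \<and> (\<forall>u. error_prob n m F N (M U1) (M U2) f h u = 0)"
proof -
  define out where "out w j k = map (\<lambda>i. received n m (X w i) k) [0..<j]" for w j k
  define good where "good u j a ys1 ys2 w \<longleftrightarrow> w u = a \<and>
    ys1 = seen F (out w (j - 1)) U1 u \<and> ys2 = seen F (out w (j - 1)) U2 u" for u j a ys1 ys2 w
  \<comment> \<open>Encoders count slots from 1 and codewords from 0, hence
    \<open>j - 1\<close>.\<close>
  define f where "f u j a ys1 ys2 = X (SOME w. good u j a ys1 ys2 w) (j - 1) u"
    for u j a ys1 ys2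
  have valid: "valid_encoder n m f"
    by (simp add: valid_encoder_def f_def carrier)
  have f_eq: "f u (Suc j) (w u) (seen F (out w j) U1 u) (seen F (out w j) U2 u) = X w j u"
    for u j w
  proof -
    let ?good = "good u (Suc j) (w u) (seen F (out w j) U1 u) (seen F (out w j) U2 u)"
    define w' where "w' = (SOME w. ?good w)"
    have "?good w"
      by (simp add: good_def)
    then have g: "?good w'"
      unfolding w'_def by (rule someI[where P = ?good])
    \<comment> \<open>The chosen \<open>w'\<close> may differ from \<open>w\<close> in the other
      message, but looks the same to transmitter \<open>u\<close>.\<close>
    have "X w' j u = X w j u"
    proof (rule causal)
      show "w' u = w u" using g by (simp add: good_def)
      fix k i assume "F k u" "i < j"
      moreover from g have "seen F (out w j) k u = seen F (out w' j) k u"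
        by (cases k) (auto simp: good_def)
      ultimately show "received n m (X w' i) k = received n m (X w i) k"
        by (auto simp: seen_def out_def)
    qed
    then show ?thesis by (simp add: f_def w'_def)
  qed
  have out: "output_seq n m F f w j = out w j" for w j
  proof (induction j)
    case (Suc j)
    then show ?case by (auto simp: Let_def f_eq) (auto simp: out_def)
  qed (auto simp: out_def)
  define h where
    "h u ys = (SOME w. (\<forall>u. w u \<in> {1..M u}) \<and> out w N u = ys) u" for u ys
  have h: "h u (out w N u) = w u" if "\<forall>u. w u \<in> {1..M u}" for u w
  proof -
    define w' where "w' = (SOME w'. (\<forall>u. w' u \<in> {1..M u}) \<and> out w' N u = out w N u)"
    have "(\<forall>u. w' u \<in> {1..M u}) \<and> out w' N u = out w N u"
      unfolding w'_def by (rule someI[of _ w]) (use that in auto)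
    then have "w' u = w u"
      using that by (intro decodable) (auto simp: out_def)
    then show ?thesis by (simp add: h_def w'_def)
  qed
  have "error_prob n m F N (M U1) (M U2) f h u = 0" for u
  proof -
    have "(message w) v \<in> {1..M v}" if "w \<in> set_pmf (message_pmf (M U1) (M U2))" for w v
      using that pos message_range by (cases w; cases v) auto
    then show ?thesis
      unfolding error_prob_def out
      by (subst measure_pmf_zero_iff) (auto simp: h)
  qed
  with valid show ?thesis by blast
qed

lemma num_messages_ge_1: "R \<ge> 0 \<Longrightarrow> num_messages N R \<ge> 1"
  unfolding num_messages_def by (simp add: le_nat_iff ge_one_powr_ge_zero)

lemma num_messages_le:
  assumes "real N * R \<le> real k"
  shows "num_messages N R \<le> 2 ^ k"
proof -
  have "2 powr (real N * R) \<le> 2 powr (real k)"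
    using assms by (intro powr_mono) auto
  then have "\<lfloor>2 powr (real N * R)\<rfloor> \<le> \<lfloor>(2::real) ^ k\<rfloor>"
    by (intro floor_mono) (simp add: powr_realpow)
  also have "\<lfloor>(2::real) ^ k\<rfloor> = 2 ^ k"
    by (metis floor_of_int of_int_numeral of_int_power)
  finally show ?thesis
    unfolding num_messages_def by (simp add: nat_le_iff)
qed

text \<open>Zero error from some block length on suffices; shorter blocks get an arbitrary
  code.\<close>

lemma achievableI:
  assumes "0 \<le> R1" "0 \<le> R2"
    and codes: "\<And>N. N \<ge> L \<Longrightarrow> \<exists>f h. valid_encoder n m f \<and>
      (\<forall>u. error_prob n m F N (num_messages N R1) (num_messages N R2) f h u = 0)"
  shows "achievable n m F R1 R2"
proof -
  have "\<exists>f h. valid_encoder n m f \<and> (N \<ge> L \<longrightarrow>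
      (\<forall>u. error_prob n m F N (num_messages N R1) (num_messages N R2) f h u = 0))" for N
  proof (cases "N \<ge> L")
    case False
    have "valid_encoder n m (\<lambda>_ _ _ _ _. 0\<^sub>v (signal_dim n m))"
      by (simp add: valid_encoder_def)
    with False show ?thesis by blast
  qed (use codes in auto)
  then obtain f h where fh: "\<And>N. valid_encoder n m (f N)"
    "\<And>N u. N \<ge> L \<Longrightarrow>
      error_prob n m F N (num_messages N R1) (num_messages N R2) (f N) (h N) u = 0"
    by metis
  have "(\<lambda>N. error_prob n m F N (num_messages N R1) (num_messages N R2) (f N) (h N) u)
      \<longlonglongrightarrow> 0" for u
    by (rule tendsto_eventually) (use fh(2) in \<open>auto simp: eventually_at_top_linorder\<close>)
  then show ?thesis
    using assms fh(1) unfolding achievable_def by blast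
qed

subsection \<open>Data bits\<close>

text \<open>Messages start at 1, so the digits are those of \<open>w - 1\<close>, cut into blocks of
  length \<open>r\<close>, one block per slot \<open>j\<close>.\<close>

definition data_bit :: "nat \<Rightarrow> nat \<Rightarrow> nat \<Rightarrow> nat \<Rightarrow> bit" where
  "data_bit r w j i = of_bool (Bit_Operations.bit (w - 1) (j * r + i))"

lemma data_bit_eq_iff:
  "data_bit r w j i = data_bit r w' j i \<longleftrightarrow>
    Bit_Operations.bit (w - 1) (j * r + i) = Bit_Operations.bit (w' - 1) (j * r + i)"
  by (simp add: data_bit_def)

lemma not_bit_message:
  fixes w :: nat
  assumes "w \<in> {1..2 ^ k}" "k \<le> p"
  shows "\<not> Bit_Operations.bit (w - 1) p"
proof -
  have "w - 1 < 2 ^ k" using assms by auto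
  then have "take_bit k (w - 1) = w - 1" by (simp add: take_bit_nat_eq_self)
  then show ?thesis using assms by (metis bit_take_bit_iff not_le)
qed

text \<open>These zero blocks are where backward decoding starts.\<close>

lemma data_bit_beyond:
  assumes "w \<in> {1..2 ^ (r * K)}" "K \<le> j"
  shows "data_bit r w j i = 0"
proof -
  have "r * K \<le> j * r + i"
    using assms(2) by (metis mult.commute mult_le_mono1 trans_le_add1)
  then show ?thesis
    using not_bit_message[OF assms(1)] by (simp add: data_bit_def)
qed

lemma data_bits_inject:
  assumes "w \<in> {1..2 ^ (r * K)}" "w' \<in> {1..2 ^ (r * K)}"
    and "\<And>j i. j < K \<Longrightarrow> i < r \<Longrightarrow> data_bit r w j i = data_bit r w' j i"
  shows "w = w'"
proof -
  have "w - 1 = w' - 1"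
  proof (rule bit_eqI)
    fix p
    show "Bit_Operations.bit (w - 1) p = Bit_Operations.bit (w' - 1) p"
    proof (cases "p < r * K")
      case True
      then have "r > 0" by (cases r) auto
      then have "p div r < K" "p mod r < r"
        using True by (auto simp: less_mult_imp_div_less mult.commute)
      from assms(3)[OF this] show ?thesis
        by (simp add: data_bit_eq_iff)
    next
      case False
      then show ?thesis
        using not_bit_message[OF assms(1)] not_bit_message[OF assms(2)] by simp
    qed
  qed
  with assms show ?thesis by auto
qed

subsection \<open>Relaying the interference\<close>

text \<open>The first input is written in terms of both messages, although its transmitter knows
  only \<open>w U1\<close>; \<open>relay_code_causal\<close> shows that feedback supplies the rest.
  Slot 0 has nothing to forward.\<close>

definition relay_code :: "nat \<Rightarrow> nat \<Rightarrow> (user \<Rightarrow> nat) \<Rightarrow> nat \<Rightarrow> user \<Rightarrow> F2vec" where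
  "relay_code n m w j u = Matrix.vec (max n m) (\<lambda>i. case u of
     U1 \<Rightarrow> if i < m then (if j = 0 then 0 else data_bit (max n m) (w U2) (j - 1) i)
           else data_bit (max n m - m) (w U1) j (i - m)
   | U2 \<Rightarrow> data_bit (max n m) (w U2) j i)"

lemma relay_code_carrier: "relay_code n m w j u \<in> carrier_vec (signal_dim n m)"
  by (simp add: relay_code_def signal_dim_def)

lemma relay_code_U1_nth:
  "i < max n m \<Longrightarrow> relay_code n m w j U1 $ i =
    (if i < m then (if j = 0 then 0 else data_bit (max n m) (w U2) (j - 1) i)
     else data_bit (max n m - m) (w U1) j (i - m))"
  by (simp add: relay_code_def)

lemma relay_code_U2_nth:
  "i < max n m \<Longrightarrow> relay_code n m w j U2 $ i = data_bit (max n m) (w U2) j i"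
  by (simp add: relay_code_def)

lemma relay_received_U1:
  assumes "i < max n m"
  shows "received n m (relay_code n m w j) U1 $ i =
    (if max n m - n \<le> i then relay_code n m w j U1 $ (i - (max n m - n)) else 0) +
    (if max n m - m \<le> i then data_bit (max n m) (w U2) j (i - (max n m - m)) else 0)"
  using assms
  by (simp only: received_nth[of "relay_code n m w j", OF relay_code_carrier] signal_dim_def
      other.simps relay_code_U2_nth less_imp_diff_less)

lemma relay_received_U2:
  assumes "i < max n m"
  shows "received n m (relay_code n m w j) U2 $ i =
    (if max n m - n \<le> i then data_bit (max n m) (w U2) j (i - (max n m - n)) else 0) +
    (if max n m - m \<le> i then relay_code n m w j U1 $ (i - (max n m - m)) else 0)"
  using assms
  by (simp only: received_nth[of "relay_code n m w j", OF relay_code_carrier] signal_dim_def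
      other.simps relay_code_U2_nth less_imp_diff_less)

text \<open>Subtracting its own input of slot \<open>l\<close> from the fed-back output, the first
  transmitter finds the top \<open>m\<close> levels of the second input, which is all it forwards in
  slot \<open>l + 1\<close>.\<close>

lemma relay_code_causal:
  assumes F: "F U1 U1 \<or> F U2 U1 \<and> m \<le> n"
    and w: "w u = w' u"
    and past: "\<And>k i. F k u \<Longrightarrow> i < j \<Longrightarrow>
      received n m (relay_code n m w i) k = received n m (relay_code n m w' i) k"
  shows "relay_code n m w j u = relay_code n m w' j u"
proof (cases u)
  case U2
  with w show ?thesis by (simp add: relay_code_def)
next
  case U1
  have "relay_code n m w l U1 = relay_code n m w' l U1" if "l \<le> j" for l
    using that
  proof (induction l)
    case 0
    show ?case
      using w U1 by (auto simp: relay_code_def)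
  next
    case (Suc l)
    then have IH: "relay_code n m w l U1 = relay_code n m w' l U1" by simp
    have "data_bit (max n m) (w U2) l p = data_bit (max n m) (w' U2) l p" if "p < m" for p
    proof (cases "F U1 U1")
      case True
      \<comment> \<open>Level \<open>p\<close> of the second input reaches receiver 1 at this
        shifted position.\<close>
      have "received n m (relay_code n m w l) U1 $ (p + (max n m - m)) =
          received n m (relay_code n m w' l) U1 $ (p + (max n m - m))"
        using past[of U1 l] True U1 Suc.prems by simp
      moreover have "p + (max n m - m) < max n m" using that by simp
      ultimately show ?thesis
        by (simp only: relay_received_U1 IH add_left_cancel le_add2 diff_add_inverse2 if_True)
    next
      case False
      \<comment> \<open>For \<open>m \<le> n\<close>, receiver 2 sees its own signal unshifted, so
        level \<open>p\<close> can be read off there.\<close>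
      then have "received n m (relay_code n m w l) U2 $ p =
          received n m (relay_code n m w' l) U2 $ p" and "m \<le> n"
        using past[of U2 l] F U1 Suc.prems by simp_all
      with that show ?thesis
        by (subst (asm) (1 2) relay_received_U2) (simp_all only: IH add_right_cancel, auto)
    qed
    then show ?case
      using w U1 by (auto simp: relay_code_def)
  qed
  with U1 show ?thesis by simp
qed

lemma backward_induct:
  fixes P :: "nat \<Rightarrow> bool"
  assumes "\<And>j. L \<le> j \<Longrightarrow> P j" and "\<And>j. j < L \<Longrightarrow> P (Suc j) \<Longrightarrow> P j"
  shows "P j"
proof (cases "j \<le> L")
  case True
  then show ?thesis
    by (induction j rule: inc_induct) (use assms in auto)
qed (use assms in auto)

text \<open>For \<open>m < n\<close>, once the interference of slot \<open>j\<close> is known, the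
  first input of that slot is known; its top \<open>m\<close> levels are the interference of slot
  \<open>j - 1\<close>.\<close>

lemma relay_code_decodable_U1:
  assumes M1: "w U1 \<in> {1..2 ^ ((max n m - m) * N)}" "w' U1 \<in> {1..2 ^ ((max n m - m) * N)}"
    and M2: "w U2 \<in> {1..2 ^ (max n m * (N - 1))}" "w' U2 \<in> {1..2 ^ (max n m * (N - 1))}"
    and rec: "\<And>i. i < N \<Longrightarrow>
      received n m (relay_code n m w i) U1 = received n m (relay_code n m w' i) U1"
  shows "w U1 = w' U1"
proof (cases "m < n")
  case False
  \<comment> \<open>The rate is zero here: the only message is 1.\<close>
  then show ?thesis
    using M1 by (simp add: max_def)
next
  case True
  then have q: "max n m = n" by simp
  have U1_eq: "relay_code n m w j U1 $ i = relay_code n m w' j U1 $ i"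
    if "\<And>p. p < m \<Longrightarrow> data_bit n (w U2) j p = data_bit n (w' U2) j p" "j < N" "i < n" for j i
  proof -
    have "received n m (relay_code n m w j) U1 $ i = received n m (relay_code n m w' j) U1 $ i"
      using rec[OF that(2)] by simp
    moreover have "data_bit n (w U2) j (i - (n - m)) = data_bit n (w' U2) j (i - (n - m))"
      if "n - m \<le> i"
      using that \<open>i < n\<close> True by (intro \<open>\<And>p. p < m \<Longrightarrow> _ p\<close>) auto
    ultimately show ?thesis
      using that(3) relay_received_U1[of i n m] by (auto simp: q split: if_splits)
  qed
  have a: "\<forall>p < m. data_bit n (w U2) j p = data_bit n (w' U2) j p" for j
  \<comment> \<open>The second message fills only \<open>N - 1\<close> blocks, so the last slot has
    no interference.\<close>
  proof (induction j rule: backward_induct[where L = "N - 1"])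
    case (1 j)
    then show ?case
      using data_bit_beyond[OF M2(1)] data_bit_beyond[OF M2(2)] by (simp add: q)
  next
    case (2 j)
    have "data_bit n (w U2) j p = data_bit n (w' U2) j p" if "p < m" for p
      using U1_eq[of "Suc j" p] 2 that True by (simp add: relay_code_U1_nth q)
    then show ?case by blast
  qed
  show ?thesis
  proof (rule data_bits_inject[OF M1])
    fix j i assume "j < N" "i < max n m - m"
    then show "data_bit (max n m - m) (w U1) j i = data_bit (max n m - m) (w' U1) j i"
      using U1_eq[of j "i + m"] a by (auto simp: relay_code_U1_nth q)
  qed
qed

text \<open>For \<open>m \<le> n\<close> the interference repeats the previous block of the second
  user, so decoding runs forward. For \<open>n < m\<close> the relayed block arrives in full, over
  part of the current block, so decoding runs backward.\<close>

lemma relay_code_decodable_U2: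
  assumes M2: "w U2 \<in> {1..2 ^ (max n m * (N - 1))}" "w' U2 \<in> {1..2 ^ (max n m * (N - 1))}"
    and rec: "\<And>i. i < N \<Longrightarrow>
      received n m (relay_code n m w i) U2 = received n m (relay_code n m w' i) U2"
  shows "w U2 = w' U2"
proof -
  let ?q = "max n m"
  have rec: "received n m (relay_code n m w j) U2 $ i = received n m (relay_code n m w' j) U2 $ i"
    if "j < N" for j i
    using rec[OF that] by simp
  have "\<forall>i < ?q. data_bit ?q (w U2) j i = data_bit ?q (w' U2) j i" for j
  proof (cases "m \<le> n")
    case True
    then have q: "?q = n" by simp
    have "j < N \<longrightarrow> (\<forall>i < n. data_bit n (w U2) j i = data_bit n (w' U2) j i)"
    proof (induction j)
      case 0
      have "data_bit n (w U2) 0 i = data_bit n (w' U2) 0 i" if "0 < N" "i < n" for i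
        using rec[OF that(1), of i] that(2) True
        by (auto simp: relay_received_U2 relay_code_U1_nth q split: if_splits)
      then show ?case by blast
    next
      case (Suc j)
      have "data_bit n (w U2) (Suc j) i = data_bit n (w' U2) (Suc j) i"
        if "Suc j < N" "i < n" for i
        using rec[OF that(1), of i] that True Suc.IH
        by (auto simp: relay_received_U2 relay_code_U1_nth q split: if_splits)
      then show ?case by blast
    qed
    moreover have "data_bit n (w U2) j i = data_bit n (w' U2) j i" if "\<not> j < N" for i
      using data_bit_beyond[OF M2(1)] data_bit_beyond[OF M2(2)] that by (simp add: q)
    ultimately show ?thesis by (auto simp: q)
  next
    case False
    then have q: "?q = m" by simp
    show ?thesis
    proof (induction j rule: backward_induct[where L = "N - 1"])
      case (1 j)
      then show ?case
        using data_bit_beyond[OF M2(1)] data_bit_beyond[OF M2(2)] by simp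
    next
      case (2 j)
      then have "Suc j < N" by simp
      have "data_bit m (w U2) j i = data_bit m (w' U2) j i" if "i < m" for i
        using rec[OF \<open>Suc j < N\<close>, of i] 2 that False
        by (auto simp: relay_received_U2 relay_code_U1_nth q split: if_splits)
      then show ?case by (simp add: q)
    qed
  qed
  then show ?thesis
    by (intro data_bits_inject[OF M2]) auto
qed

text \<open>Leaving the last block empty costs the second user the rate \<open>max n m / N\<close>,
  which is at most the fixed loss \<open>max n m / (k + 1)\<close> once \<open>N > k\<close>. The
  loss vanishes in the closure as \<open>k\<close> grows.\<close>

lemma relay_achievable:
  assumes F: "F U1 U1 \<or> F U2 U1 \<and> m \<le> n"
  shows "achievable n m F (real (max n m - m)) (real (max n m) - real (max n m) / (real k + 1))"
    (is "achievable n m F ?R1 ?R2")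
proof -
  have R2: "?R2 \<ge> 0"
    by (simp add: field_simps)
  show ?thesis
  proof (rule achievableI[where L = "k + 1"])
    fix N assume N: "N \<ge> k + 1"
    have M1: "num_messages N ?R1 \<le> 2 ^ ((max n m - m) * N)"
      by (rule num_messages_le) (simp add: mult.commute)
    have "real N * ?R2 \<le> real (max n m * (N - 1))"
    proof -
      have "real (max n m) * (real N / (real k + 1)) \<ge> real (max n m) * 1"
        using N by (intro mult_left_mono) auto
      moreover have "real (max n m * (N - 1)) = real (max n m) * (real N - 1)"
        using N by (simp add: of_nat_diff)
      ultimately show ?thesis
        by (simp add: algebra_simps)
    qed
    then have M2: "num_messages N ?R2 \<le> 2 ^ (max n m * (N - 1))"
      by (rule num_messages_le)
    define M where "M u = (case u of U1 \<Rightarrow> num_messages N ?R1 | U2 \<Rightarrow> num_messages N ?R2)" for u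
    have "\<exists>f h. valid_encoder n m f \<and> (\<forall>u. error_prob n m F N (M U1) (M U2) f h u = 0)"
    proof (rule realize_code[where X = "relay_code n m"])
      fix w w' :: "user \<Rightarrow> nat" and u
      assume w: "\<And>u. w u \<in> {1..M u}" and w': "\<And>u. w' u \<in> {1..M u}"
        and rec: "\<And>i. i < N \<Longrightarrow>
          received n m (relay_code n m w i) u = received n m (relay_code n m w' i) u"
      have ranges: "w U1 \<in> {1..2 ^ ((max n m - m) * N)}" "w' U1 \<in> {1..2 ^ ((max n m - m) * N)}"
        "w U2 \<in> {1..2 ^ (max n m * (N - 1))}" "w' U2 \<in> {1..2 ^ (max n m * (N - 1))}"
        using w[of U1] w'[of U1] w[of U2] w'[of U2] M1 M2 by (auto simp: M_def)
      show "w u = w' u"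
        by (cases u)
           (use rec relay_code_decodable_U1[of w n m N w', OF ranges]
              relay_code_decodable_U2[of w n m N w', OF ranges(3,4)]
             in auto)
    next
      show "M u \<ge> 1" for u
        using R2 by (cases u) (simp_all only: M_def user.case num_messages_ge_1 of_nat_0_le_iff)
    qed (use relay_code_carrier relay_code_causal[of F, OF F] in blast)+
    then show "\<exists>f h. valid_encoder n m f \<and>
        (\<forall>u. error_prob n m F N (num_messages N ?R1) (num_messages N ?R2) f h u = 0)"
      by (simp add: M_def)
  qed (use R2 in auto)
qed

lemma relay_capacity:
  assumes "F U1 U1 \<or> F U2 U1 \<and> m \<le> n"
  shows "(real (max n m - m), real (max n m)) \<in> capacity_region n m F"
proof -
  let ?r = "\<lambda>k. (real (max n m - m), real (max n m) - real (max n m) / (real k + 1))"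
  have "(\<lambda>k. real (max n m) - real (max n m) / (real k + 1)) \<longlonglongrightarrow> real (max n m) - 0"
    by (intro tendsto_diff tendsto_const real_tendsto_divide_at_top)
       (auto intro!: filterlim_tendsto_add_at_top[OF tendsto_const] filterlim_real_sequentially
         simp: add.commute[of _ 1])
  then have "?r \<longlonglongrightarrow> (real (max n m - m), real (max n m))"
    by (intro tendsto_Pair) auto
  moreover have "?r k \<in> {(R1, R2). achievable n m F R1 R2}" for k
    using relay_achievable[where F = F, OF assms] by simp
  ultimately show ?thesis
    unfolding capacity_region_def closure_sequential by (intro exI[of _ ?r]) blast
qed

subsection \<open>Strong interference without feedback\<close>

text \<open>The second transmitter uses its top \<open>n\<close> levels, so that \<open>r = min (m - n) n\<close> consecutive
  levels of the first transmitter reach each receiver cleanly, at offset \<open>n - r\<close> for the first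
  and offset \<open>0\<close> for the second. A periodic word of period \<open>r\<close> is determined by both windows.\<close>

definition direct_code :: "nat \<Rightarrow> nat \<Rightarrow> (user \<Rightarrow> nat) \<Rightarrow> nat \<Rightarrow> user \<Rightarrow> F2vec" where
  "direct_code n m w j u = Matrix.vec (max n m) (\<lambda>i. case u of
     U1 \<Rightarrow> data_bit (min (m - n) n) (w U1) j (i mod min (m - n) n)
   | U2 \<Rightarrow> if i < n then data_bit n (w U2) j i else 0)"

lemma direct_code_carrier: "direct_code n m w j u \<in> carrier_vec (signal_dim n m)"
  by (simp add: direct_code_def signal_dim_def)

lemma direct_received_U1:
  assumes "n \<le> m" "i < m"
  shows "received n m (direct_code n m w j) U1 $ i =
    (if m - n \<le> i then data_bit (min (m - n) n) (w U1) j ((i - (m - n)) mod min (m - n) n) else 0) +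
    (if i < n then data_bit n (w U2) j i else 0)"
  using assms received_nth[of "direct_code n m w j" n m i U1, OF direct_code_carrier]
  by (simp add: signal_dim_def max_absorb2 direct_code_def)

lemma direct_received_U2:
  assumes "n \<le> m" "i < m"
  shows "received n m (direct_code n m w j) U2 $ i =
    (if m - n \<le> i then data_bit n (w U2) j (i - (m - n)) else 0) +
    data_bit (min (m - n) n) (w U1) j (i mod min (m - n) n)"
  using assms received_nth[of "direct_code n m w j" n m i U2, OF direct_code_carrier]
  by (auto simp: signal_dim_def max_absorb2 direct_code_def)

lemma direct_code_decodable_U1:
  assumes "n \<le> m"
    and M1: "w U1 \<in> {1..2 ^ (min (m - n) n * N)}" "w' U1 \<in> {1..2 ^ (min (m - n) n * N)}"
    and rec: "\<And>i. i < N \<Longrightarrow>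
      received n m (direct_code n m w i) U1 = received n m (direct_code n m w' i) U1"
  shows "w U1 = w' U1"
proof (rule data_bits_inject[OF M1])
  let ?r = "min (m - n) n"
  fix j p assume j: "j < N" and p: "p < ?r"
  define s where "s = n - ?r"
  \<comment> \<open>\<open>t\<close> is the index in the window from \<open>s\<close> to
    \<open>n - 1\<close> that is congruent to \<open>p\<close> modulo \<open>?r\<close>; adding
    \<open>?r * s\<close> prevents truncated subtraction.\<close>
  define t where "t = s + (p + ?r * s - s) mod ?r"
  have "s \<le> ?r * s" using p by simp
  then have "s + (p + ?r * s - s) = ?r * s + p" by linarith
  then have "t mod ?r = (?r * s + p) mod ?r"
    by (simp only: t_def mod_add_right_eq)
  also have "\<dots> = p" using p by (simp only: mod_mult_self4 mod_less)
  finally have mod: "t mod ?r = p" .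
  have "(p + ?r * s - s) mod ?r < ?r"
    using p by (intro mod_less_divisor) linarith
  then have "s \<le> t" "t < s + ?r" by (auto simp: t_def)
  \<comment> \<open>The window arrives below the top \<open>n\<close> levels, the only ones hit by
    the second user, because \<open>?r \<le> m - n\<close>.\<close>
  then have "\<not> t + (m - n) < n" "t + (m - n) < m" "m - n \<le> t + (m - n)"
    using \<open>n \<le> m\<close> p by (auto simp: s_def min_def split: if_splits)
  then show "data_bit ?r (w U1) j p = data_bit ?r (w' U1) j p"
    using arg_cong[OF rec[OF j], of "\<lambda>v. v $ (t + (m - n))"]
    by (simp only: direct_received_U1[OF \<open>n \<le> m\<close>] if_True if_False add_0_right
        diff_add_inverse2 mod)
qed

text \<open>The top \<open>min (m - n) n\<close> levels contain only the first signal, so receiver 2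
  decodes the first message and then strips its signal from the remaining levels.\<close>

lemma direct_code_decodable_U2:
  assumes "n \<le> m"
    and M1: "w U1 \<in> {1..2 ^ (min (m - n) n * N)}" "w' U1 \<in> {1..2 ^ (min (m - n) n * N)}"
    and M2: "w U2 \<in> {1..2 ^ (n * N)}" "w' U2 \<in> {1..2 ^ (n * N)}"
    and rec: "\<And>i. i < N \<Longrightarrow>
      received n m (direct_code n m w i) U2 = received n m (direct_code n m w' i) U2"
  shows "w U2 = w' U2"
proof -
  let ?r = "min (m - n) n"
  have rec: "received n m (direct_code n m w j) U2 $ i = received n m (direct_code n m w' j) U2 $ i"
    if "j < N" for j i
    using rec[OF that] by simp
  have U1: "w U1 = w' U1"
  proof (rule data_bits_inject[OF M1])
    fix j i assume "j < N" "i < ?r"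
    then show "data_bit ?r (w U1) j i = data_bit ?r (w' U1) j i"
      using rec[of j i] \<open>n \<le> m\<close> by (simp add: direct_received_U2)
  qed
  show ?thesis
  proof (rule data_bits_inject[OF M2])
    fix j i assume "j < N" "i < n"
    then have "i + (m - n) < m" using \<open>n \<le> m\<close> by simp
    then show "data_bit n (w U2) j i = data_bit n (w' U2) j i"
      using rec[OF \<open>j < N\<close>, of "i + (m - n)"]
      by (simp only: direct_received_U2[OF \<open>n \<le> m\<close>] U1 le_add2 if_True diff_add_inverse2
          add_right_cancel)
  qed
qed

lemma direct_capacity:
  assumes "n \<le> m"
  shows "(real (min (m - n) n), real n) \<in> capacity_region n m F"
proof -
  let ?R1 = "real (min (m - n) n)" and ?R2 = "real n"
  have "achievable n m F ?R1 ?R2"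
  proof (rule achievableI[where L = 0])
    fix N
    define M where "M u = (case u of U1 \<Rightarrow> num_messages N ?R1 | U2 \<Rightarrow> num_messages N ?R2)" for u
    have M: "M U1 \<le> 2 ^ (min (m - n) n * N)" "M U2 \<le> 2 ^ (n * N)"
      unfolding M_def by (auto intro!: num_messages_le)
    have "\<exists>f h. valid_encoder n m f \<and> (\<forall>u. error_prob n m F N (M U1) (M U2) f h u = 0)"
    proof (rule realize_code[where X = "direct_code n m"])
      fix w w' :: "user \<Rightarrow> nat" and u
      assume w: "\<And>u. w u \<in> {1..M u}" and w': "\<And>u. w' u \<in> {1..M u}"
        and rec: "\<And>i. i < N \<Longrightarrow>
          received n m (direct_code n m w i) u = received n m (direct_code n m w' i) u"
      have ranges: "w U1 \<in> {1..2 ^ (min (m - n) n * N)}" "w' U1 \<in> {1..2 ^ (min (m - n) n * N)}"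
        "w U2 \<in> {1..2 ^ (n * N)}" "w' U2 \<in> {1..2 ^ (n * N)}"
        using w[of U1] w'[of U1] w[of U2] w'[of U2] M by auto
      show "w u = w' u"
        by (cases u)
           (use rec direct_code_decodable_U1[of n m w N w', OF assms ranges(1,2)]
             direct_code_decodable_U2[of n m w N w', OF assms ranges] in auto)
    next
      fix w w' :: "user \<Rightarrow> nat" and u j
      assume "w u = w' u"
      then show "direct_code n m w j u = direct_code n m w' j u"
        by (cases u) (auto simp: direct_code_def)
    next
      show "M u \<ge> 1" for u
        by (cases u) (simp_all only: M_def user.case num_messages_ge_1 of_nat_0_le_iff)
    qed (rule direct_code_carrier)
    then show "\<exists>f h. valid_encoder n m f \<and>
        (\<forall>u. error_prob n m F N (num_messages N ?R1) (num_messages N ?R2) f h u = 0)"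
      by (simp add: M_def)
  qed auto
  then show ?thesis
    unfolding capacity_region_def by (intro closure_subset[THEN subsetD]) auto
qed

subsection \<open>Converse\<close>

lemma finite_card_F2vec:
  "finite (carrier_vec k :: F2vec set)" "card (carrier_vec k :: F2vec set) \<le> 2 ^ k"
proof -
  have bits: "(UNIV :: bit set) = {0, 1}" by auto
  let ?L = "{xs :: bit list. set xs \<subseteq> {0, 1} \<and> length xs = k}"
  have fin: "finite ?L" by (rule finite_lists_length_eq) simp
  have "card ?L = 2 ^ k" by (subst card_lists_length_eq) (simp_all add: numeral_2_eq_2)
  moreover have sub: "(carrier_vec k :: F2vec set) \<subseteq> vec_of_list ` ?L"
  proof
    fix v :: F2vec assume "v \<in> carrier_vec k"
    then have "v = vec_of_list (list_of_vec v)" "list_of_vec v \<in> ?L"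
      using bits by (auto simp: vec_list)
    then show "v \<in> vec_of_list ` ?L" by blast
  qed
  ultimately show "finite (carrier_vec k :: F2vec set)"
    "card (carrier_vec k :: F2vec set) \<le> 2 ^ k"
    using surj_card_le[OF fin sub] fin by (auto intro: finite_subset)
qed

definition F2words :: "nat \<Rightarrow> nat \<Rightarrow> F2vec list set" where
  "F2words k N = {ys. set ys \<subseteq> carrier_vec k \<and> length ys = N}"

lemma finite_card_F2words:
  "finite (F2words k N)" "card (F2words k N) \<le> 2 ^ (N * k)"
proof -
  show "finite (F2words k N)"
    unfolding F2words_def by (intro finite_lists_length_eq finite_card_F2vec)
  have "card (F2words k N) = card (carrier_vec k :: F2vec set) ^ N"
    unfolding F2words_def by (intro card_lists_length_eq finite_card_F2vec)
  also have "\<dots> \<le> (2 ^ k) ^ N"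
    by (intro power_mono finite_card_F2vec) simp
  finally show "card (F2words k N) \<le> 2 ^ (N * k)"
    by (simp add: mult.commute flip: power_mult)
qed

section \<open>Sum bound under arbitrary feedback\<close>

definition levels :: "nat \<Rightarrow> nat \<Rightarrow> F2vec \<Rightarrow> F2vec" where
  "levels k l y = Matrix.vec k (\<lambda>i. y $ (i + l))"

lemma levels_nth: "levels k l y = levels k l y' \<Longrightarrow> l \<le> i \<Longrightarrow> i < k + l \<Longrightarrow> y $ i = y' $ i"
proof -
  assume "levels k l y = levels k l y'" and i: "l \<le> i" "i < k + l"
  then have "levels k l y $ (i - l) = levels k l y' $ (i - l)" by simp
  moreover have "i - l + l = i" "i - l < k" using i by auto
  ultimately show "y $ i = y' $ i" by (simp add: levels_def)
qed

text \<open>With the first input known, the first output reveals the top \<open>m\<close> levels of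
  the second input. The levels of the second output that these leave open are exactly the given
  window, which is empty for \<open>n \<le> m\<close>.\<close>

lemma received_determined:
  assumes X: "\<And>u. X u \<in> carrier_vec (signal_dim n m)" "\<And>u. X' u \<in> carrier_vec (signal_dim n m)"
    and U1: "X U1 = X' U1" and Y1: "received n m X U1 = received n m X' U1"
    and levels: "levels (n - m) m (received n m X U2) = levels (n - m) m (received n m X' U2)"
  shows "received n m X U2 = received n m X' U2"
proof -
  let ?q = "signal_dim n m"
  have U2: "X U2 $ p = X' U2 $ p" if "p < m" for p
  proof -
    have "p + (?q - m) < ?q" using that by (simp add: signal_dim_def)
    moreover have "received n m X U1 $ (p + (?q - m)) = received n m X' U1 $ (p + (?q - m))"
      using Y1 by simp
    ultimately show ?thesis
      by (simp only: received_nth[OF X(1)] received_nth[OF X(2)] U1 other.simps add_left_cancel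
          le_add2 if_True diff_add_inverse2)
  qed
  show ?thesis
  proof (rule eq_vecI)
    fix i assume "i < dim_vec (received n m X' U2)"
    then have i: "i < ?q"
      using received_carrier[of X' U2 n m] X by auto
    show "received n m X U2 $ i = received n m X' U2 $ i"
    \<comment> \<open>In both cases the own signal at level \<open>i\<close>, if any, comes from the
      top \<open>m\<close> levels of the second input.\<close>
    proof (cases "i < m \<or> n \<le> m")
      case True
      then have "?q - n \<le> i \<Longrightarrow> X U2 $ (i - (?q - n)) = X' U2 $ (i - (?q - n))"
        using i by (intro U2) (auto simp: signal_dim_def max_def split: if_splits)
      with i show ?thesis
        by (simp add: received_nth[OF X(1)] received_nth[OF X(2)] U1)
    next
      case False
      with levels i show ?thesis
        by (intro levels_nth) (auto simp: signal_dim_def)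
    qed
  qed (use received_carrier[of X U2 n m] received_carrier[of X' U2 n m] X in auto)
qed

text \<open>By induction both past outputs agree, so the first transmitter sees the same past for
  any choice of links and repeats its input.\<close>

lemma output_determined:
  assumes f: "valid_encoder n m f" and w: "w U1 = w' U1"
  shows "output_seq n m F f w N U1 = output_seq n m F f w' N U1 \<Longrightarrow>
    map (levels (n - m) m) (output_seq n m F f w N U2) =
      map (levels (n - m) m) (output_seq n m F f w' N U2) \<Longrightarrow>
    output_seq n m F f w N U2 = output_seq n m F f w' N U2"
proof (induction N)
  case (Suc N)
  define X where "X w = (\<lambda>u. f u (Suc N) (w u) (seen F (output_seq n m F f w N) U1 u)
    (seen F (output_seq n m F f w N) U2 u))" for w
  have out: "output_seq n m F f w (Suc N) k = output_seq n m F f w N k @ [received n m (X w) k]"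
    for w k
    by (simp add: X_def Let_def)
  note prems = Suc.prems[unfolded out map_append list.map append1_eq_conv]
  have X: "X w u \<in> carrier_vec (signal_dim n m)" for w u
    using f by (simp add: X_def valid_encoder_def)
  have IH: "output_seq n m F f w N k = output_seq n m F f w' N k" for k
    using Suc.IH prems by (cases k) blast+
  moreover have "received n m (X w) U2 = received n m (X w') U2"
  proof (rule received_determined)
    show "X w U1 = X w' U1" using IH w by (simp add: X_def seen_def)
  qed (use X prems in blast)+
  ultimately show ?case by (simp only: out)
qed simp

lemma card_correct_both_le:
  assumes f: "valid_encoder n m f"
  shows "card {w \<in> {1..M1} \<times> {1..M2}. \<forall>u. h u (output_seq n m F f (message w) N u) = message w u}
    \<le> 2 ^ (N * (max n m + (n - m)))" (is "card ?G \<le> _")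
proof -
  define Y where "Y w k = output_seq n m F f (message w) N k" for w k
  let ?enc = "\<lambda>w. (Y w U1, map (levels (n - m) m) (Y w U2))"
  have "inj_on ?enc ?G"
  proof (rule inj_onI)
    fix w w' assume G: "w \<in> ?G" "w' \<in> ?G" and enc: "?enc w = ?enc w'"
    have "message w U1 = message w' U1"
      using G enc by (metis (mono_tags, lifting) Pair_inject Y_def mem_Collect_eq)
    moreover from this have "Y w U2 = Y w' U2"
      using enc output_determined[of n m f "message w" "message w'", OF f] by (auto simp: Y_def)
    then have "message w U2 = message w' U2"
      using G by (metis (mono_tags, lifting) Y_def mem_Collect_eq)
    ultimately show "w = w'" by (cases w; cases w') simp
  qed
  moreover have "?enc ` ?G \<subseteq> F2words (max n m) N \<times> F2words (n - m) N"
    using output_seq_carrier[OF f, THEN subsetD] by (auto simp: F2words_def Y_def signal_dim_def levels_def)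
  ultimately have "card ?G \<le> card (F2words (max n m) N \<times> F2words (n - m) N)"
    by (intro card_inj_on_le finite_cartesian_product finite_card_F2words)
  also have "\<dots> \<le> 2 ^ (N * max n m) * 2 ^ (N * (n - m))"
    unfolding card_cartesian_product by (intro mult_mono finite_card_F2words) auto
  finally show ?thesis
    by (simp add: power_add distrib_left)
qed

section \<open>Individual rate bounds under cross feedback\<close>

text \<open>Transmitter \<open>other u\<close> sees at most the output at \<open>u\<close>, so its
  input agrees by induction. Only the lowest \<open>n\<close> levels of that output contain the
  signal of \<open>u\<close>; the levels above are pure interference.\<close>

lemma output_determined_cross:
  assumes f: "valid_encoder n m f" and w: "w (other u) = w' (other u)"
    and F: "\<not> F (other u) (other u)"
  shows "map (levels n (max n m - n)) (output_seq n m F f w N u) =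
      map (levels n (max n m - n)) (output_seq n m F f w' N u) \<Longrightarrow>
    output_seq n m F f w N u = output_seq n m F f w' N u"
proof (induction N)
  case (Suc N)
  define X where "X w = (\<lambda>u. f u (Suc N) (w u) (seen F (output_seq n m F f w N) U1 u)
    (seen F (output_seq n m F f w N) U2 u))" for w
  have out: "output_seq n m F f w (Suc N) k = output_seq n m F f w N k @ [received n m (X w) k]"
    for w k
    by (simp add: X_def Let_def)
  have X: "X w u \<in> carrier_vec (signal_dim n m)" for w u
    using f by (simp add: X_def valid_encoder_def)
  note prems = Suc.prems[unfolded out map_append list.map append1_eq_conv]
  have IH: "output_seq n m F f w N u = output_seq n m F f w' N u"
    using Suc.IH prems by blast
  have other: "X w (other u) = X w' (other u)"
    using IH F w by (cases u) (auto simp: X_def seen_def)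
  have levels: "levels n (max n m - n) (received n m (X w) u) =
      levels n (max n m - n) (received n m (X w') u)"
    using prems by blast
  have "received n m (X w) u = received n m (X w') u"
  proof (rule eq_vecI)
    fix i assume "i < dim_vec (received n m (X w') u)"
    then have i: "i < signal_dim n m"
      using received_carrier[of "X w'" u n m] X by auto
    show "received n m (X w) u $ i = received n m (X w') u $ i"
    proof (cases "max n m - n \<le> i")
      case True
      with i show ?thesis
        by (intro levels_nth[OF levels]) (auto simp: signal_dim_def)
    next
      case False
      with i show ?thesis
        by (simp only: received_nth[OF X] other) (simp only: signal_dim_def if_False)
    qed
  qed (use received_carrier[of "X w" u n m] received_carrier[of "X w'" u n m] X in auto)
  with IH show ?case by (simp only: out)
qed simp

lemma card_correct_le_cross:
  assumes f: "valid_encoder n m f" and F: "\<not> F (other u) (other u)"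
  shows "card {w \<in> {1..M U1} \<times> {1..M U2}. h u (output_seq n m F f (message w) N u) = message w u}
    \<le> M (other u) * 2 ^ (N * n)" (is "card ?G \<le> _")
proof -
  define Y where "Y w = output_seq n m F f (message w) N u" for w
  let ?enc = "\<lambda>w. (message w (other u), map (levels n (max n m - n)) (Y w))"
  have "inj_on ?enc ?G"
  proof (rule inj_onI)
    fix w w' assume G: "w \<in> ?G" "w' \<in> ?G" and enc: "?enc w = ?enc w'"
    then have "Y w = Y w'"
      using output_determined_cross[of n m f "message w" u "message w'" F, OF f _ F]
      by (auto simp: Y_def)
    then have "message w u = message w' u"
      using G by (metis (mono_tags, lifting) Y_def mem_Collect_eq)
    with enc show "w = w'" by (cases w; cases w'; cases u) simp_all
  qed
  moreover have "?enc ` ?G \<subseteq> {1..M (other u)} \<times> F2words n N"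
    by (cases u) (auto simp: F2words_def Y_def levels_def)
  ultimately have "card ?G \<le> card ({1..M (other u)} \<times> F2words n N)"
    by (intro card_inj_on_le finite_cartesian_product finite_card_F2words) auto
  also have "\<dots> \<le> M (other u) * 2 ^ (N * n)"
    unfolding card_cartesian_product by (intro mult_mono finite_card_F2words) auto
  finally show ?thesis .
qed

section \<open>From counting to rates\<close>

text \<open>Error probability at most 1/2 leaves half of the message pairs correct, a factor 2 that
  does not affect the rate.\<close>

lemma card_correct_ge:
  assumes "M1 \<ge> 1" "M2 \<ge> 1"
    and "measure_pmf.prob (message_pmf M1 M2) {w. \<not> P w} \<le> 1 / 2"
  shows "M1 * M2 \<le> 2 * card {w \<in> {1..M1} \<times> {1..M2}. P w}"
proof -
  let ?A = "{1..M1} \<times> {1..M2}"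
  have "message_pmf M1 M2 = pmf_of_set ?A"
    using assms by (intro pmf_eqI) (auto simp: message_pmf_def pmf_pair indicator_def)
  then have "real (card (?A \<inter> {w. \<not> P w})) / (M1 * M2) \<le> 1 / 2"
    using assms measure_pmf_of_set[of ?A "{w. \<not> P w}"] by simp
  then have "2 * card (?A \<inter> {w. \<not> P w}) \<le> M1 * M2"
    using assms by (simp add: field_simps flip: of_nat_mult)
  moreover have "{w \<in> ?A. P w} = ?A - {w. \<not> P w}" by auto
  then have "card ?A = card (?A \<inter> {w. \<not> P w}) + card {w \<in> ?A. P w}"
    by (simp only: card_Int_Diff[OF finite_cartesian_product[OF finite_atLeastAtMost finite_atLeastAtMost]])
  ultimately show ?thesis by (simp add: card_cartesian_product)
qed

text \<open>Rounding down a real number that is at least 1 loses at most a factor 2.\<close>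

lemma num_messages_ge: "2 powr (real N * R) \<le> 2 * real (num_messages N R)" if "R \<ge> 0"
proof -
  have "2 powr (real N * R) < of_int \<lfloor>2 powr (real N * R)\<rfloor> + 1" by linarith
  also have "\<dots> = real (num_messages N R) + 1"
    by (simp add: num_messages_def)
  also have "\<dots> \<le> 2 * real (num_messages N R)"
    using num_messages_ge_1[OF that, of N] by simp
  finally show ?thesis by simp
qed

text \<open>Constant factors do not matter: if \<open>R > c\<close>, then \<open>(R - c) * N\<close>
  eventually exceeds \<open>K\<close>.\<close>

lemma exponent_le:
  fixes R K :: real and c :: nat
  assumes "\<forall>\<^sub>F N in sequentially. 2 powr (real N * R) \<le> 2 powr K * 2 ^ (N * c)"
  shows "R \<le> c"
proof (rule ccontr)
  assume "\<not> R \<le> c"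
  then have "filterlim (\<lambda>N. (R - c) * real N) at_top sequentially"
    by (intro filterlim_tendsto_pos_mult_at_top[OF tendsto_const _ filterlim_real_sequentially]) auto
  then have "\<forall>\<^sub>F N in sequentially. K < (R - c) * real N"
    by (simp add: filterlim_at_top_dense)
  with assms have "\<forall>\<^sub>F N :: nat in sequentially. False"
  proof eventually_elim
    case (elim N)
    have "2 powr (real N * R) \<le> 2 powr (K + real (N * c))"
      using elim(1) by (simp add: powr_add powr_realpow del: of_nat_mult)
    then have "real N * R \<le> K + real (N * c)" by simp
    with elim(2) show ?case by (simp add: algebra_simps)
  qed
  then show False by simp
qed

lemma all_user_iff: "(\<forall>u. P u) \<longleftrightarrow> P U1 \<and> P U2"
  by (metis user.exhaust)

lemma sum_rate_le:
  assumes "achievable n m F R1 R2"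
  shows "R1 + R2 \<le> real (max n m + (n - m))"
proof -
  from assms obtain f h where R: "0 \<le> R1" "0 \<le> R2"
    and f: "\<And>N. valid_encoder n m (f N)"
    and err: "\<And>u. (\<lambda>N. error_prob n m F N (num_messages N R1) (num_messages N R2) (f N) (h N) u)
      \<longlonglongrightarrow> 0"
    unfolding achievable_def by blast
  \<comment> \<open>The bound 1/4 for each user gives 1/2 in the union bound.\<close>
  have small: "\<forall>\<^sub>F N in sequentially.
      error_prob n m F N (num_messages N R1) (num_messages N R2) (f N) (h N) u < 1 / 4" for u
    by (rule order_tendstoD[OF err]) simp
  show ?thesis
  \<comment> \<open>One factor 2 for the half of correct pairs and one for rounding each of the two
    message numbers.\<close>
  proof (rule exponent_le[where K = 3])
    show "\<forall>\<^sub>F N in sequentially. 2 powr (real N * (R1 + R2)) \<le>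
        2 powr 3 * 2 ^ (N * (max n m + (n - m)))"
      using small[of U1] small[of U2]
    proof eventually_elim
      case (elim N)
      let ?M1 = "num_messages N R1" and ?M2 = "num_messages N R2"
      let ?ok = "\<lambda>u w. h N u (output_seq n m F (f N) (message w) N u) = message w u"
      have "measure_pmf.prob (message_pmf ?M1 ?M2) {w. \<not> (\<forall>u. ?ok u w)} \<le>
          measure_pmf.prob (message_pmf ?M1 ?M2) ({w. \<not> ?ok U1 w} \<union> {w. \<not> ?ok U2 w})"
        unfolding all_user_iff by (intro measure_pmf.finite_measure_mono) (blast, simp)
      also have "\<dots> \<le> measure_pmf.prob (message_pmf ?M1 ?M2) {w. \<not> ?ok U1 w} +
          measure_pmf.prob (message_pmf ?M1 ?M2) {w. \<not> ?ok U2 w}"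
        by (rule measure_Un_le) auto
      also have "\<dots> \<le> 1 / 2"
        using elim by (simp add: error_prob_def)
      finally have "?M1 * ?M2 \<le> 2 * card {w \<in> {1..?M1} \<times> {1..?M2}. \<forall>u. ?ok u w}"
        using R by (intro card_correct_ge num_messages_ge_1)
      also have "\<dots> \<le> 2 * 2 ^ (N * (max n m + (n - m)))"
        using card_correct_both_le[OF f, of "?M1" "?M2" "h N"] by simp
      finally have "real (?M1 * ?M2) \<le> real (2 * 2 ^ (N * (max n m + (n - m))))"
        by (rule of_nat_mono)
      then have M: "real ?M1 * real ?M2 \<le> 2 * 2 ^ (N * (max n m + (n - m)))"
        by simp
      have "2 powr (real N * (R1 + R2)) = 2 powr (real N * R1) * 2 powr (real N * R2)"
        by (simp add: powr_add distrib_left)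
      also have "\<dots> \<le> (2 * real ?M1) * (2 * real ?M2)"
        using R by (intro mult_mono num_messages_ge) auto
      also have "\<dots> \<le> 2 powr 3 * 2 ^ (N * (max n m + (n - m)))"
        using M by simp
      finally show ?case .
    qed
  qed
qed

lemma cross_rate_le:
  assumes "achievable n m F R1 R2" and F: "\<not> F (other u) (other u)"
  shows "(case u of U1 \<Rightarrow> R1 | U2 \<Rightarrow> R2) \<le> real n"
proof -
  let ?R = "\<lambda>u. case u of U1 \<Rightarrow> R1 | U2 \<Rightarrow> R2"
  from assms(1) obtain f h where R: "0 \<le> R1" "0 \<le> R2"
    and f: "\<And>N. valid_encoder n m (f N)"
    and err: "\<And>u. (\<lambda>N. error_prob n m F N (num_messages N R1) (num_messages N R2) (f N) (h N) u)
      \<longlonglongrightarrow> 0"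
    unfolding achievable_def by blast
  have R: "?R u \<ge> 0" for u using R by (cases u) auto
  have small: "\<forall>\<^sub>F N in sequentially.
      error_prob n m F N (num_messages N R1) (num_messages N R2) (f N) (h N) u < 1 / 2"
    by (rule order_tendstoD[OF err]) simp
  show ?thesis
  \<comment> \<open>One factor 2 for the half of correct pairs and one for rounding; the number of
    messages of the other user cancels.\<close>
  proof (rule exponent_le[where K = 2])
    show "\<forall>\<^sub>F N in sequentially. 2 powr (real N * ?R u) \<le> 2 powr 2 * 2 ^ (N * n)"
      using small
    proof eventually_elim
      case (elim N)
      define M where "M u = num_messages N (?R u)" for u
      have M1: "M u \<ge> 1" for u
        unfolding M_def by (rule num_messages_ge_1[OF R])
      have "M U1 * M U2 \<le>
          2 * card {w \<in> {1..M U1} \<times> {1..M U2}.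
            h N u (output_seq n m F (f N) (message w) N u) = message w u}"
        using elim by (intro card_correct_ge M1) (simp add: error_prob_def M_def)
      also have "\<dots> \<le> 2 * (M (other u) * 2 ^ (N * n))"
        using card_correct_le_cross[where F = F and u = u and M = M and h = "h N", OF f F] by simp
      finally have "M (other u) * M u \<le> M (other u) * (2 * 2 ^ (N * n))"
        by (cases u) (simp_all add: ac_simps)
      then have "M u \<le> 2 * 2 ^ (N * n)"
        using M1[of "other u"] by (subst (asm) mult_le_cancel1) auto
      then have "real (M u) \<le> real (2 * 2 ^ (N * n))" by (rule of_nat_mono)
      then show ?case
        using num_messages_ge[OF R, of N u] by (simp add: M_def)
    qed
  qed
qed

section \<open>Sum-capacities\<close>

text \<open>The upper bound passes to the capacity region because a closed half-plane contains the
  closure.\<close>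

lemma has_sum_capacityI:
  assumes "(R1, R2) \<in> capacity_region n m F" "R1 + R2 = C"
    and "\<And>R1 R2. achievable n m F R1 R2 \<Longrightarrow> R1 + R2 \<le> C"
  shows "has_sum_capacity n m F C"
proof -
  have "closed {p :: real \<times> real. fst p + snd p \<le> C}"
    by (intro closed_Collect_le continuous_intros)
  then have "capacity_region n m F \<subseteq> {p. fst p + snd p \<le> C}"
    unfolding capacity_region_def using assms(3) by (intro closure_minimal) auto
  then show ?thesis
    using assms(1,2) unfolding has_sum_capacity_def by force
qed

lemma has_sum_capacity_direct_feedback:
  assumes "F U1 U1"
  shows "has_sum_capacity n m F (max (real n - real m) 0 + max (real n) (real m))"
proof (rule has_sum_capacityI)
  show "(real (max n m - m), real (max n m)) \<in> capacity_region n m F"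
    using assms by (intro relay_capacity) simp
  show "R1 + R2 \<le> max (real n - real m) 0 + max (real n) (real m)"
    if "achievable n m F R1 R2" for R1 R2
    using sum_rate_le[OF that] by (auto simp: max_def of_nat_diff split: if_splits)
qed (auto simp: max_def of_nat_diff)

text \<open>For \<open>m \<le> n\<close> the minimum is \<open>2 * n - m\<close>, attained by
  relaying. For \<open>n < m\<close> it is \<open>min m (2 * n)\<close>, which equals
  \<open>min (m - n) n + n\<close> and is attained by the direct code.\<close>

lemma has_sum_capacity_cross_feedback:
  assumes "\<not> F U1 U1" "\<not> F U2 U2" "F U2 U1"
  shows "has_sum_capacity n m F
    (min (max (real n - real m) 0 + max (real n) (real m)) (2 * real n))"
proof -
  let ?C = "min (max (real n - real m) 0 + max (real n) (real m)) (2 * real n)"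
  have upper: "R1 + R2 \<le> ?C" if "achievable n m F R1 R2" for R1 R2
    using sum_rate_le[OF that] cross_rate_le[where F = F and u = U1, OF that]
      cross_rate_le[where F = F and u = U2, OF that] assms
    by (auto simp: max_def of_nat_diff split: if_splits)
  show ?thesis
  proof (cases "m \<le> n")
    case True
    show ?thesis
    proof (rule has_sum_capacityI[OF _ _ upper])
      show "(real (max n m - m), real (max n m)) \<in> capacity_region n m F"
        using assms True by (intro relay_capacity) simp
    qed (use True in \<open>auto simp: max_def of_nat_diff\<close>)
  next
    case False
    show ?thesis
    proof (rule has_sum_capacityI[OF _ _ upper])
      show "(real (min (m - n) n), real n) \<in> capacity_region n m F"
        using False by (intro direct_capacity) simp
    qed (use False in \<open>auto simp: max_def min_def of_nat_diff split: if_splits\<close>)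
  qed
qed

theorem mainTheorem2:
  fixes n m :: nat
  shows "(\<forall>F12 F21 F22. has_sum_capacity n m (feedback_model True F12 F21 F22)
            (max (real n - real m) 0 + max (real n) (real m)))
       \<and> has_sum_capacity n m (feedback_model False True True False)
            (min (max (real n - real m) 0 + max (real n) (real m)) (2 * real n))
       \<and> has_sum_capacity n m (feedback_model False False True False)
            (min (max (real n - real m) 0 + max (real n) (real m)) (2 * real n))"
  using has_sum_capacity_direct_feedback has_sum_capacity_cross_feedback by simp

end
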